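(* Let $(X(t))_{t\ge 0}$ be a wide sense stationary Unit CTMC with generator parameters $\alpha,\beta$ satisfying $\alpha\neq\beta$, and let $R$ be its autocorrelation function. Then: (i) $R\notin L^{p}(\mathbb{R})$ for any real $p\ge 1$, i.e. the $L^p$ norm of $R$ is infinite; (ii) as $p\to\infty$, the $L^{p}$-norm of $R$ approaches a finite constant; (iii) the $L^{\infty}$-norm of $R$ is equal to $1$.
   Context: A Unit CTMC is a homogeneous continuous time Markov chain $(X(t))_{t\ge 0}$ with state space $\{+1,-1\}$ and generator matrix (states ordered $+1,-1$) $Q=\begin{bmatrix}-\alpha & \alpha\\ \beta & -\beta\end{bmatrix}$ with $\alpha,\beta\ge 0$, so that $P\{X(t+\tau)=j\mid X(t)=i\}=(e^{Q\tau})_{ij}$ for $t,\tau\ge 0$. Wide sense stationary means that $E[X(t)]$ does not depend on $t$ and $E[X(t)X(t+\tau)]$ depends only on $\tau$. The autocorrelation function is $R(\tau)=E[X(0)X(\tau)]$ for $\tau\ge 0$, extended to all real lags by symmetry, $R(-\tau)=R(\tau)$. The spaces $L^p(\mathbb{R})$ and their norms are with respect to Lebesgue measure in the lag $\tau\in\mathbb{R}$.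
   Formalization: Part (ii) contradicts (i), since the L^p norm over the whole line is infinite for every finite p; it is replaced by: as p→∞ the L^p norms of R over each bounded window [-T,T], T>0, approach one and the same finite constant. *)

theory Defs
  imports "HOL-Probability.Probability"
begin

primrec matrix_power :: "real^'n^'n \<Rightarrow> nat \<Rightarrow> real^'n^'n" where
  "matrix_power A 0 = mat 1"
| "matrix_power A (Suc k) = A ** matrix_power A k"

(* The library function exp does not apply here: it needs a normed algebra, and the
   matrix product ** is not the multiplication of a type class instance. *)
definition matrix_exp :: "real^'n^'n \<Rightarrow> real^'n^'n" where
  "matrix_exp A = (\<Sum>k. (1 / fact k) *\<^sub>R matrix_power A k)"

definition unit_generator :: "real \<Rightarrow> real \<Rightarrow> real^2^2" where
  "unit_generator \<alpha> \<beta> = vector [vector [-\<alpha>, \<alpha>], vector [\<beta>, -\<beta>]]"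

(* Row and column of a state: the states are ordered +1, -1. *)
definition state_index :: "real \<Rightarrow> 2" where
  "state_index s = (if s = 1 then 1 else 2)"

(* Only the times t >= 0 matter; X t is unconstrained for t < 0. Conditional
   probabilities are restricted to conditioning events of positive probability. The
   first of the two conditional statements is the Markov property (given the present X t,
   any finite part of the past is irrelevant); the second is the homogeneous
   transition law. *)
definition unit_ctmc ::
  "'a measure \<Rightarrow> real \<Rightarrow> real \<Rightarrow> (real \<Rightarrow> 'a \<Rightarrow> real) \<Rightarrow> bool" where
  "unit_ctmc M \<alpha> \<beta> X \<longleftrightarrow>
     prob_space M \<and> 0 \<le> \<alpha> \<and> 0 \<le> \<beta> \<and>
     (\<forall>t\<ge>0. X t \<in> borel_measurable M) \<and>
     (\<forall>t\<ge>0. \<forall>\<omega>\<in>space M. X t \<omega> \<in> {1, -1}) \<and>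
     (\<forall>t\<ge>0. \<forall>\<tau>\<ge>0. \<forall>F x. \<forall>i\<in>{1, -1}. \<forall>j\<in>{1, -1}.
        finite F \<and> F \<subseteq> {0..<t} \<and>
        \<P>(\<omega> in M. X t \<omega> = i \<and> (\<forall>s\<in>F. X s \<omega> = x s)) > 0 \<longrightarrow>
        \<P>(\<omega> in M. X (t + \<tau>) \<omega> = j \<bar> X t \<omega> = i \<and> (\<forall>s\<in>F. X s \<omega> = x s)) =
        \<P>(\<omega> in M. X (t + \<tau>) \<omega> = j \<bar> X t \<omega> = i)) \<and>
     (\<forall>t\<ge>0. \<forall>\<tau>\<ge>0. \<forall>i\<in>{1, -1}. \<forall>j\<in>{1, -1}.
        \<P>(\<omega> in M. X t \<omega> = i) > 0 \<longrightarrow>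
        \<P>(\<omega> in M. X (t + \<tau>) \<omega> = j \<bar> X t \<omega> = i) =
        matrix_exp (\<tau> *\<^sub>R unit_generator \<alpha> \<beta>) $ state_index i $ state_index j)"

definition wide_sense_stationary :: "'a measure \<Rightarrow> (real \<Rightarrow> 'a \<Rightarrow> real) \<Rightarrow> bool" where
  "wide_sense_stationary M X \<longleftrightarrow>
     (\<forall>s\<ge>0. \<forall>t\<ge>0. (\<integral>\<omega>. X s \<omega> \<partial>M) = (\<integral>\<omega>. X t \<omega> \<partial>M)) \<and>
     (\<forall>s\<ge>0. \<forall>t\<ge>0. \<forall>\<tau>\<ge>0.
        (\<integral>\<omega>. X s \<omega> * X (s + \<tau>) \<omega> \<partial>M) = (\<integral>\<omega>. X t \<omega> * X (t + \<tau>) \<omega> \<partial>M))"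

definition autocorrelation :: "'a measure \<Rightarrow> (real \<Rightarrow> 'a \<Rightarrow> real) \<Rightarrow> real \<Rightarrow> real" where
  "autocorrelation M X \<tau> = (\<integral>\<omega>. X 0 \<omega> * X \<bar>\<tau>\<bar> \<omega> \<partial>M)"

(* The extended non-negative reals have no power with real exponents, hence the case
   distinction. In particular a function that is not p-integrable has norm infinity,
   unlike with the real-valued Bochner integral, which would give 0. *)
definition ennreal_root :: "real \<Rightarrow> ennreal \<Rightarrow> ennreal" where
  "ennreal_root p x = (if x = \<infinity> then \<infinity> else ennreal (enn2real x powr (1 / p)))"

definition Lp_norm :: "real \<Rightarrow> 'b measure \<Rightarrow> ('b \<Rightarrow> real) \<Rightarrow> ennreal" where
  "Lp_norm p N f = ennreal_root p (\<integral>\<^sup>+x. ennreal (\<bar>f x\<bar> powr p) \<partial>N)"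

definition Lp_space :: "real \<Rightarrow> 'b measure \<Rightarrow> ('b \<Rightarrow> real) set" where
  "Lp_space p N = {f \<in> borel_measurable N. Lp_norm p N f < \<infinity>}"

definition Linf_norm :: "'b measure \<Rightarrow> ('b \<Rightarrow> real) \<Rightarrow> ennreal" where
  "Linf_norm N f = esssup N (\<lambda>x. ennreal \<bar>f x\<bar>)"

(* The norms of f over the bounded windows [-T, T] tend to one and the same value c as
   p tends to infinity, whatever T > 0 is. For a function whose norm over the whole line
   is infinite for every finite p, the limit of those whole-line norms is trivially
   infinite; exhausting the line by windows and letting p tend to infinity on each
   of them is then the sense in which the norm can have a finite limit. *)
definition windowed_Lp_norm_tendsto :: "(real \<Rightarrow> real) \<Rightarrow> ennreal \<Rightarrow> bool" where
  "windowed_Lp_norm_tendsto f c \<longleftrightarrow>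
     (\<forall>T>0. ((\<lambda>p. Lp_norm p (restrict_space lborel {-T..T}) f) \<longlongrightarrow> c) at_top)"

end

theory Submission
  imports Defs
begin

(* The generator Q satisfies Q^2 = -(\<alpha> + \<beta>) Q, so e^{Q\<tau>} = I + (1 - e^{-(\<alpha> + \<beta>)\<tau>}) / (\<alpha> + \<beta>) Q.
   Stationarity of the mean forces P(X 0 = 1) = \<beta> / (\<alpha> + \<beta>), and therefore
   R(\<tau>) = m^2 + (1 - m^2) e^{-(\<alpha> + \<beta>)|\<tau>|} with m = (\<beta> - \<alpha>) / (\<alpha> + \<beta>) the mean.
   Since \<alpha> and \<beta> differ, R is bounded below by m^2 > 0, so no power of it is integrable over
   the line; and R is continuous with its maximum 1 at lag 0, which is both its essential
   supremum and the limit of its L^p norms over bounded windows. *)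

section \<open>The transition matrix\<close>

text \<open>Each further factor A contributes one factor c. The index starts at \<open>Suc k\<close>
  because the zeroth power is the identity, in general no multiple of A.\<close>

lemma matrix_power_square_scalar:
  fixes A :: "real^'n^'n"
  assumes "A ** A = c *\<^sub>R A"
  shows "matrix_power A (Suc k) = c ^ k *\<^sub>R A"
proof (induction k)
  case 0
  show ?case by simp
next
  case (Suc k)
  have "matrix_power A (Suc (Suc k)) = A ** (c ^ k *\<^sub>R A)"
    using Suc by simp
  also have "\<dots> = c ^ k *\<^sub>R (A ** A)"
    by (simp add: scalar_matrix_assoc matrix_scalar_ac flip: scalar_mult_eq_scaleR)
  finally show ?case by (simp add: assms)
qed

lemma matrix_exp_square_scalar:
  fixes A :: "real^'n^'n"
  assumes "A ** A = c *\<^sub>R A" "c \<noteq> 0"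
  shows "matrix_exp A = mat 1 + ((exp c - 1) / c) *\<^sub>R A"
proof -
  \<comment> \<open>From k = 1 on, the terms are those of the series of \<open>exp c\<close> times A
    / c. At k = 0 that series would give A / c in place of the identity, which the one-term
    correction repairs.\<close>
  have eq: "(1 / fact k) *\<^sub>R matrix_power A k =
      (if k = 0 then mat 1 - (1 / c) *\<^sub>R A else 0) + (c ^ k /\<^sub>R fact k) *\<^sub>R ((1 / c) *\<^sub>R A)" for k
    using assms(2)
    by (cases k) (simp_all add: matrix_power_square_scalar[OF assms(1)] divide_simps del: matrix_power.simps(2))
  have "(\<lambda>k. (1 / fact k) *\<^sub>R matrix_power A k) sums
      ((mat 1 - (1 / c) *\<^sub>R A) + exp c *\<^sub>R ((1 / c) *\<^sub>R A))"
    unfolding eq by (intro sums_add sums_scaleR_left exp_converges sums_single)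
  then show ?thesis
    unfolding matrix_exp_def by (auto simp: sums_iff algebra_simps diff_divide_distrib)
qed

text \<open>Cayley-Hamilton: the generator has determinant 0 and trace -(\<alpha> +
  \<beta>).\<close>

lemma unit_generator_square:
  "(\<tau> *\<^sub>R unit_generator \<alpha> \<beta>) ** (\<tau> *\<^sub>R unit_generator \<alpha> \<beta>) =
     (-(\<alpha> + \<beta>) * \<tau>) *\<^sub>R (\<tau> *\<^sub>R unit_generator \<alpha> \<beta>)"
  by (simp add: vec_eq_iff forall_2 matrix_matrix_mult_def sum_2 unit_generator_def vector_2)
     (simp add: algebra_simps)

lemma matrix_exp_unit_generator:
  assumes "\<alpha> + \<beta> \<noteq> 0"
  shows "matrix_exp (\<tau> *\<^sub>R unit_generator \<alpha> \<beta>) =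
    mat 1 + ((1 - exp (-(\<alpha> + \<beta>) * \<tau>)) / (\<alpha> + \<beta>)) *\<^sub>R unit_generator \<alpha> \<beta>"
\<comment> \<open>At \<tau> = 0 the scalar -(\<alpha> + \<beta>)\<tau> vanishes, and
  \<open>matrix_exp_square_scalar\<close> divides by it.\<close>
proof (cases "\<tau> = 0")
  case True
  have "(\<lambda>k. (1 / fact k) *\<^sub>R matrix_power (0 :: real^2^2) k) = (\<lambda>k. if k = 0 then mat 1 else 0)"
    by (rule ext, case_tac k) simp_all
  then have "matrix_exp (0 :: real^2^2) = mat 1"
    unfolding matrix_exp_def using sums_single[of 0 "\<lambda>_. mat 1 :: real^2^2"] by (simp add: sums_iff)
  with True show ?thesis by simp
next
  case False
  have "matrix_exp (\<tau> *\<^sub>R unit_generator \<alpha> \<beta>) = mat 1 +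
      ((exp (-(\<alpha> + \<beta>) * \<tau>) - 1) / (-(\<alpha> + \<beta>) * \<tau>)) *\<^sub>R (\<tau> *\<^sub>R unit_generator \<alpha> \<beta>)"
    using False assms by (intro matrix_exp_square_scalar unit_generator_square) simp
  also have "\<dots> = mat 1 + ((exp (-(\<alpha> + \<beta>) * \<tau>) - 1) / (-(\<alpha> + \<beta>))) *\<^sub>R unit_generator \<alpha> \<beta>"
    using False by simp
  also have "(exp (-(\<alpha> + \<beta>) * \<tau>) - 1) / (-(\<alpha> + \<beta>)) = (1 - exp (-(\<alpha> + \<beta>) * \<tau>)) / (\<alpha> + \<beta>)"
    using minus_divide_divide[of "1 - exp (-(\<alpha> + \<beta>) * \<tau>)" "\<alpha> + \<beta>"] by simp
  finally show ?thesis .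
qed

section \<open>Autocorrelation\<close>

text \<open>The product of two states is 1 if they agree and -1 if not, so R is 1 minus twice the
  probability of disagreement, which the law of \<open>X 0\<close> and the transition matrix
  determine. The coefficient of the last factor is 1 - m^2, the variance of
  \<open>X 0\<close>.\<close>

lemma autocorrelation_unit_ctmc:
  fixes \<alpha> \<beta> :: real
  assumes "unit_ctmc M \<alpha> \<beta> X" "wide_sense_stationary M X" "\<alpha> + \<beta> > 0"
  shows "autocorrelation M X \<tau> =
    1 - 4 * \<alpha> * \<beta> / (\<alpha> + \<beta>)\<^sup>2 * (1 - exp (-(\<alpha> + \<beta>) * \<bar>\<tau>\<bar>))"
proof -
  interpret prob_space M using assms(1) by (simp add: unit_ctmc_def)
  have meas [measurable]: "X t \<in> borel_measurable M" if "t \<ge> 0" for t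
    using assms(1) that by (simp add: unit_ctmc_def)
  have vals: "X t \<omega> = 1 \<or> X t \<omega> = -1" if "t \<ge> 0" "\<omega> \<in> space M" for t \<omega>
    using assms(1) that by (auto simp: unit_ctmc_def)
  define u where "u t = (1 - exp (-(\<alpha> + \<beta>) * t)) / (\<alpha> + \<beta>)" for t
  define P where "P t i = prob {\<omega> \<in> space M. X t \<omega> = i}" for t i
  define J where "J t i j = prob {\<omega> \<in> space M. X t \<omega> = j \<and> X 0 \<omega> = i}" for t i j
  define E where "E t i j = matrix_exp (t *\<^sub>R unit_generator \<alpha> \<beta>) $ state_index i $ state_index j"
    for t i j
  have E: "E t 1 1 = 1 - \<alpha> * u t" "E t 1 (-1) = \<alpha> * u t"
    "E t (-1) 1 = \<beta> * u t" "E t (-1) (-1) = 1 - \<beta> * u t" for t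
    using assms(3) unfolding E_def u_def
    by (simp_all add: matrix_exp_unit_generator state_index_def mat_def)
       (simp_all add: unit_generator_def vector_2)
  have J: "J t i j = P 0 i * E t i j" if "t \<ge> 0" "i \<in> {1, -1}" "j \<in> {1, -1}" for t i j
  \<comment> \<open>The transition law speaks only of conditioning events of positive probability;
    for a null initial state both sides are 0.\<close>
  proof (cases "P 0 i > 0")
    case True
    have "\<forall>t\<ge>0. \<forall>\<tau>\<ge>0. \<forall>i\<in>{1, -1}. \<forall>j\<in>{1, -1}. P t i > 0 \<longrightarrow>
        \<P>(\<omega> in M. X (t + \<tau>) \<omega> = j \<bar> X t \<omega> = i) = E \<tau> i j"
      using assms(1) unfolding unit_ctmc_def P_def E_def by (elim conjE)
    from this[rule_format, of 0 t i j] have "\<P>(\<omega> in M. X t \<omega> = j \<bar> X 0 \<omega> = i) = E t i j"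
      using that True by simp
    then show ?thesis using True by (simp add: cond_prob_def J_def P_def field_simps)
  next
    case False
    have "J t i j \<le> P 0 i"
      unfolding J_def P_def using that by (intro finite_measure_mono) auto
    moreover have "J t i j \<ge> 0" by (simp add: J_def)
    moreover have "P 0 i = 0" using False by (simp add: P_def order_less_le)
    ultimately show ?thesis by simp
  qed
  have P_compl: "P t (-1) = 1 - P t 1" if "t \<ge> 0" for t
  proof -
    have "{\<omega> \<in> space M. X t \<omega> = -1} = space M - {\<omega> \<in> space M. X t \<omega> = 1}"
      using vals[OF that] by auto
    then show ?thesis unfolding P_def using that by (simp add: prob_compl)
  qed
  have P_step: "P t 1 = J t 1 1 + J t (-1) 1" if "t \<ge> 0" for t
  proof -
    have "{\<omega> \<in> space M. X t \<omega> = 1} = {\<omega> \<in> space M. X t \<omega> = 1 \<and> X 0 \<omega> = 1} \<union>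
        {\<omega> \<in> space M. X t \<omega> = 1 \<and> X 0 \<omega> = -1}"
      using vals[of 0] by auto
    then show ?thesis unfolding P_def J_def using that
      by simp (rule finite_measure_Union; auto)
  qed
  have mean: "(\<integral>\<omega>. X t \<omega> \<partial>M) = 2 * P t 1 - 1" if "t \<ge> 0" for t
  proof -
    have "(\<integral>\<omega>. X t \<omega> \<partial>M) = (\<integral>\<omega>. 2 * indicator {\<omega> \<in> space M. X t \<omega> = 1} \<omega> - 1 \<partial>M)"
      using vals[OF that] by (intro Bochner_Integration.integral_cong) (auto simp: indicator_def)
    also have "\<dots> = 2 * P t 1 - 1"
      unfolding P_def using that
      by (subst Bochner_Integration.integral_diff)
         (auto simp: prob_space emeasure_eq_measure)
    finally show ?thesis .
  qed
  \<comment> \<open>Equal means at times 0 and 1 give a linear equation for \<open>P 0 1\<close>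
    with the common factor \<open>u 1\<close>; its positivity allows cancelling.\<close>
  have "u 1 > 0" using assms(3) by (simp add: u_def)
  have "(\<integral>\<omega>. X 1 \<omega> \<partial>M) = (\<integral>\<omega>. X 0 \<omega> \<partial>M)"
    using assms(2) by (simp add: wide_sense_stationary_def)
  then have "P 1 1 = P 0 1" by (simp add: mean)
  then have "P 0 1 * (1 - \<alpha> * u 1) + (1 - P 0 1) * (\<beta> * u 1) = P 0 1"
    using P_step[of 1] J[of 1] P_compl[of 0] by (simp add: E)
  then have "u 1 * (\<beta> - P 0 1 * (\<alpha> + \<beta>)) = 0" by (simp add: algebra_simps)
  then have P0: "P 0 1 = \<beta> / (\<alpha> + \<beta>)"
    using \<open>u 1 > 0\<close> assms(3) by (simp add: nonzero_eq_divide_eq)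
  have "(\<integral>\<omega>. X 0 \<omega> * X t \<omega> \<partial>M) = 1 - 2 * J t 1 (-1) - 2 * J t (-1) 1" if "t \<ge> 0" for t
  proof -
    let ?I = "\<lambda>i j. indicator {\<omega> \<in> space M. X t \<omega> = j \<and> X 0 \<omega> = i} :: 'a \<Rightarrow> real"
    have [simp]: "integrable M (?I i j)" for i j
      using that by (simp add: emeasure_eq_measure)
    have "(\<integral>\<omega>. X 0 \<omega> * X t \<omega> \<partial>M) = (\<integral>\<omega>. 1 - 2 * ?I 1 (-1) \<omega> - 2 * ?I (-1) 1 \<omega> \<partial>M)"
    proof (rule Bochner_Integration.integral_cong)
      fix \<omega> assume "\<omega> \<in> space M"
      then show "X 0 \<omega> * X t \<omega> = 1 - 2 * ?I 1 (-1) \<omega> - 2 * ?I (-1) 1 \<omega>"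
        using vals[OF that, of \<omega>] vals[of 0 \<omega>] by auto
    qed simp
    also have "\<dots> = 1 - 2 * J t 1 (-1) - 2 * J t (-1) 1"
      unfolding J_def using that by (simp add: prob_space emeasure_eq_measure)
    finally show ?thesis .
  qed
  from this[of "\<bar>\<tau>\<bar>"] have "autocorrelation M X \<tau> =
      1 - 2 * (\<beta> / (\<alpha> + \<beta>) * \<alpha> * u \<bar>\<tau>\<bar> + (1 - \<beta> / (\<alpha> + \<beta>)) * \<beta> * u \<bar>\<tau>\<bar>)"
    by (simp add: autocorrelation_def J E P_compl P0)
  also have "1 - \<beta> / (\<alpha> + \<beta>) = \<alpha> / (\<alpha> + \<beta>)" using assms(3) by (simp add: field_simps)
  finally show ?thesis by (simp add: u_def power2_eq_square)
qed

section \<open>Norms of functions on the line\<close>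

lemma ennreal_root_mono: "p > 0 \<Longrightarrow> x \<le> y \<Longrightarrow> ennreal_root p x \<le> ennreal_root p y"
  by (auto simp: ennreal_root_def top.not_eq_extremum top_unique
      intro!: ennreal_leI powr_mono2 enn2real_mono)

text \<open>This is the L^p norm of the constant b over a set of measure l, the comparison value in
  both window bounds below.\<close>

lemma ennreal_root_powr_mult:
  assumes "p > 0" "b \<ge> 0" "l \<ge> 0"
  shows "ennreal_root p (ennreal (b powr p * l)) = ennreal (b * l powr (1 / p))"
  using assms by (simp add: ennreal_root_def powr_mult powr_powr)

text \<open>The line has infinite length, so the constant c alone has infinite integral.\<close>

lemma nn_integral_lborel_ge_infinite:
  assumes "c > 0" "\<And>x. c \<le> f x"
  shows "(\<integral>\<^sup>+x. f x \<partial>(lborel :: real measure)) = \<infinity>"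
proof -
  have "(\<integral>\<^sup>+x. c \<partial>(lborel :: real measure)) \<le> (\<integral>\<^sup>+x. f x \<partial>lborel)"
    by (intro nn_integral_mono assms)
  then show ?thesis using assms(1) by (auto simp: top_unique split: if_splits)
qed

lemma Lp_norm_window_le:
  assumes "p > 0" "T > 0" "\<And>x. \<bar>f x\<bar> \<le> C"
  shows "Lp_norm p (restrict_space lborel {-T..T}) f \<le> ennreal (C * (2 * T) powr (1 / p))"
proof -
  have "C \<ge> 0" using assms(3)[of 0] by simp
  have "(\<integral>\<^sup>+x. ennreal (\<bar>f x\<bar> powr p) \<partial>restrict_space lborel {-T..T}) \<le>
      (\<integral>\<^sup>+x. ennreal (C powr p) \<partial>restrict_space lborel {-T..T})"
    using assms by (intro nn_integral_mono ennreal_leI powr_mono2) auto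
  also have "\<dots> = ennreal (C powr p * (2 * T))"
    using assms by (simp add: emeasure_restrict_space space_restrict_space ennreal_mult)
  finally show ?thesis
    unfolding Lp_norm_def using ennreal_root_mono[OF assms(1)]
      ennreal_root_powr_mult[of p C "2 * T"] assms \<open>C \<ge> 0\<close> by fastforce
qed

lemma Lp_norm_window_ge:
  assumes "p > 0" "d > 0" "d \<le> T" "b \<ge> 0" "\<And>x. \<bar>x\<bar> \<le> d \<Longrightarrow> b \<le> \<bar>f x\<bar>"
  shows "ennreal (b * (2 * d) powr (1 / p)) \<le> Lp_norm p (restrict_space lborel {-T..T}) f"
proof -
  have "ennreal (b powr p * (2 * d)) = (\<integral>\<^sup>+x. ennreal (b powr p) * indicator {-d..d} x \<partial>lborel)"
    using assms by (simp add: nn_integral_cmult_indicator ennreal_mult)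
  also have "\<dots> \<le> (\<integral>\<^sup>+x. ennreal (\<bar>f x\<bar> powr p) * indicator {-T..T} x \<partial>lborel)"
    using assms by (intro nn_integral_mono) (auto simp: indicator_def intro!: ennreal_leI powr_mono2)
  also have "\<dots> = (\<integral>\<^sup>+x. ennreal (\<bar>f x\<bar> powr p) \<partial>restrict_space lborel {-T..T})"
    by (simp add: nn_integral_restrict_space)
  finally show ?thesis
    unfolding Lp_norm_def using ennreal_root_mono[OF assms(1)]
      ennreal_root_powr_mult[of p b "2 * d"] assms by fastforce
qed

text \<open>The length factor tends to l^0 = 1, so the size of the comparison interval is forgotten
  in the limit.\<close>

lemma tendsto_ennreal_mult_powr_inverse:
  assumes "l > 0"
  shows "((\<lambda>p. ennreal (b * l powr (1 / p))) \<longlongrightarrow> ennreal b) at_top"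
proof -
  have "((\<lambda>p. b * l powr (1 / p)) \<longlongrightarrow> b * l powr 0) at_top"
    using assms by (intro tendsto_intros) (auto intro!: real_tendsto_divide_at_top filterlim_ident)
  then show ?thesis using assms by (intro tendsto_ennrealI) simp
qed

text \<open>From above, f is compared with the constant \<open>\<bar>f 0\<bar>\<close> on the whole
  window; from below, with a slightly smaller constant on a short interval around 0, where
  continuity keeps f large.\<close>

lemma windowed_Lp_norm_tendsto_max:
  assumes "isCont f 0" "\<And>x. \<bar>f x\<bar> \<le> \<bar>f 0\<bar>"
  shows "windowed_Lp_norm_tendsto f (ennreal \<bar>f 0\<bar>)"
  unfolding windowed_Lp_norm_tendsto_def
proof (intro allI impI order_tendstoI)
  fix T :: real and a assume "T > 0" and a: "a < ennreal \<bar>f 0\<bar>"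
  \<comment> \<open>Both gaps are used: b < |f 0| yields a neighbourhood of 0 by continuity, and a <
    b absorbs the length factor for large p.\<close>
  obtain b' where b': "a < b'" "b' < ennreal \<bar>f 0\<bar>" using dense[OF a] by blast
  obtain b where b: "b' = ennreal b" "b \<ge> 0" using b'(2) by (cases b') auto
  have "b < \<bar>f 0\<bar>" using b' b by (simp add: ennreal_less_iff)
  moreover have "((\<lambda>x. \<bar>f x\<bar>) \<longlongrightarrow> \<bar>f 0\<bar>) (at 0)"
    using assms(1) by (intro tendsto_rabs) (simp add: isCont_def)
  ultimately have "\<forall>\<^sub>F x in at 0. b < \<bar>f x\<bar>" by (rule order_tendstoD(1)[rotated])
  then obtain e where e: "e > 0" "\<And>x. x \<noteq> 0 \<Longrightarrow> \<bar>x\<bar> < e \<Longrightarrow> b < \<bar>f x\<bar>"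
    by (auto simp: eventually_at)
  \<comment> \<open>T keeps [-d, d] inside the window, and e / 2 keeps this closed interval within
    the open range of radius e. The point 0, absent from the punctured neighbourhood, is covered by
    b < |f 0|.\<close>
  define d where "d = min T (e / 2)"
  have d: "d > 0" "d \<le> T" "\<And>x. \<bar>x\<bar> \<le> d \<Longrightarrow> b \<le> \<bar>f x\<bar>"
  proof -
    show "d > 0" "d \<le> T" using \<open>T > 0\<close> e(1) by (auto simp: d_def)
    show "b \<le> \<bar>f x\<bar>" if "\<bar>x\<bar> \<le> d" for x
      using e(1) e(2)[of x] \<open>b < \<bar>f 0\<bar>\<close> that by (cases "x = 0") (auto simp: d_def)
  qed
  have "\<forall>\<^sub>F p in at_top. a < ennreal (b * (2 * d) powr (1 / p))"
    using tendsto_ennreal_mult_powr_inverse[of "2 * d" b] b' b d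
    by (intro order_tendstoD) auto
  then show "\<forall>\<^sub>F p in at_top. a < Lp_norm p (restrict_space lborel {-T..T}) f"
    using eventually_gt_at_top[of 0]
    by eventually_elim (erule less_le_trans, rule Lp_norm_window_ge[OF _ d(1,2) b(2) d(3)])
next
  fix T :: real and a assume "T > 0" and a: "ennreal \<bar>f 0\<bar> < a"
  have "\<forall>\<^sub>F p in at_top. ennreal (\<bar>f 0\<bar> * (2 * T) powr (1 / p)) < a"
    using tendsto_ennreal_mult_powr_inverse[of "2 * T" "\<bar>f 0\<bar>"] a \<open>T > 0\<close>
    by (intro order_tendstoD) auto
  then show "\<forall>\<^sub>F p in at_top. Lp_norm p (restrict_space lborel {-T..T}) f < a"
    using eventually_gt_at_top[of 0]
    by eventually_elim (rule le_less_trans[OF Lp_norm_window_le[OF _ \<open>T > 0\<close> assms(2)]])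
qed

text \<open>The essential supremum bounds |f| only almost everywhere. By continuity the set where
  the bound holds is closed, and a closed set of full measure contains every point, in particular
  0.\<close>

lemma Linf_norm_max:
  fixes f :: "real \<Rightarrow> real"
  assumes "continuous_on UNIV f" "\<And>x. \<bar>f x\<bar> \<le> \<bar>f 0\<bar>"
  shows "Linf_norm lborel f = ennreal \<bar>f 0\<bar>"
proof (rule antisym)
  have meas: "(\<lambda>x. ennreal \<bar>f x\<bar>) \<in> borel_measurable lborel"
    using borel_measurable_continuous_onI[OF assms(1)] by measurable
  show "Linf_norm lborel f \<le> ennreal \<bar>f 0\<bar>"
    unfolding Linf_norm_def using meas assms(2) by (intro esssup_I) (auto intro!: ennreal_leI)
  \<comment> \<open>The passage to the completed measure serves
    \<open>mem_closed_if_AE_lebesgue\<close>.\<close>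
  have "AE x in lebesgue. x \<in> {x. ennreal \<bar>f x\<bar> \<le> Linf_norm lborel f}"
    using esssup_AE[of "\<lambda>x. ennreal \<bar>f x\<bar>" lborel] unfolding Linf_norm_def
    by (intro AE_completion) simp
  moreover have "closed {x. ennreal \<bar>f x\<bar> \<le> Linf_norm lborel f}"
    using assms(1) by (intro closed_Collect_le continuous_on_ennreal continuous_intros)
  ultimately have "0 \<in> {x. ennreal \<bar>f x\<bar> \<le> Linf_norm lborel f}"
    by (rule mem_closed_if_AE_lebesgue[rotated])
  then show "ennreal \<bar>f 0\<bar> \<le> Linf_norm lborel f" by simp
qed

theorem lemma1:
  fixes M :: "'a measure" and X :: "real \<Rightarrow> 'a \<Rightarrow> real" and \<alpha> \<beta> :: real
  assumes "unit_ctmc M \<alpha> \<beta> X"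
    and "wide_sense_stationary M X"
    and "\<alpha> \<noteq> \<beta>"
  shows "(\<forall>p\<ge>1. autocorrelation M X \<notin> Lp_space p lborel \<and>
                  Lp_norm p lborel (autocorrelation M X) = \<infinity>) \<and>
         (\<exists>c<\<infinity>. windowed_Lp_norm_tendsto (autocorrelation M X) c) \<and>
         Linf_norm lborel (autocorrelation M X) = 1"
proof -
  define R where "R = autocorrelation M X"
  have nonneg: "\<alpha> \<ge> 0" "\<beta> \<ge> 0" using assms(1) by (auto simp: unit_ctmc_def)
  with assms(3) have pos: "\<alpha> + \<beta> > 0" by linarith
  \<comment> \<open>With m the mean, q = 1 - m^2, and 1 - q is the limit of R at infinite
    lag.\<close>
  define q where "q = 4 * \<alpha> * \<beta> / (\<alpha> + \<beta>)\<^sup>2"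
  have R: "R = (\<lambda>\<tau>. 1 - q * (1 - exp (-(\<alpha> + \<beta>) * \<bar>\<tau>\<bar>)))"
    using autocorrelation_unit_ctmc[OF assms(1,2) pos] unfolding R_def q_def by blast
  have "q \<ge> 0" using nonneg by (simp add: q_def)
  \<comment> \<open>The difference of (\<alpha> + \<beta>)^2 and 4\<alpha>\<beta> is this square, so
    unequal rates keep the lower bound 1 - q of R positive.\<close>
  have "0 < (\<alpha> - \<beta>)\<^sup>2" using assms(3) by simp
  then have "4 * \<alpha> * \<beta> < (\<alpha> + \<beta>)\<^sup>2" by (simp add: power2_eq_square algebra_simps)
  then have "q < 1" using pos by (simp add: q_def)
  have exp_le: "exp (-(\<alpha> + \<beta>) * \<bar>\<tau>\<bar>) \<le> 1" for \<tau>
    using nonneg by (simp add: mult_nonpos_nonneg)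
  have R_ge: "1 - q \<le> R \<tau>" for \<tau>
    using \<open>q \<ge> 0\<close> by (simp add: R mult_left_le)
  have R_le: "R \<tau> \<le> 1" for \<tau>
    using \<open>q \<ge> 0\<close> exp_le[of \<tau>] by (simp add: R)
  have R_abs: "\<bar>R \<tau>\<bar> \<le> \<bar>R 0\<bar>" and R0: "R 0 = 1" for \<tau>
    using R_ge[of \<tau>] R_le[of \<tau>] \<open>q < 1\<close> by (simp_all add: R)
  have cont: "continuous_on UNIV R" unfolding R by (intro continuous_intros)
  have norm: "Lp_norm p lborel R = \<infinity>" if "p \<ge> 1" for p
  proof -
    have "(1 - q) powr p \<le> \<bar>R \<tau>\<bar> powr p" for \<tau>
      using R_ge[of \<tau>] \<open>q < 1\<close> that by (intro powr_mono2) auto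
    then have "(\<integral>\<^sup>+\<tau>. ennreal (\<bar>R \<tau>\<bar> powr p) \<partial>lborel) = \<infinity>"
      using \<open>q < 1\<close>
      by (intro nn_integral_lborel_ge_infinite[of "ennreal ((1 - q) powr p)"]) (auto intro: ennreal_leI)
    then show ?thesis by (simp add: Lp_norm_def ennreal_root_def)
  qed
  moreover have "windowed_Lp_norm_tendsto R 1"
    using windowed_Lp_norm_tendsto_max[of R] R_abs R0 cont
    by (simp add: continuous_on_eq_continuous_at)
  moreover have "Linf_norm lborel R = 1"
    using Linf_norm_max[OF cont R_abs] R0 by simp
  ultimately show ?thesis
    unfolding R_def Lp_space_def by (auto intro!: exI[of _ 1])
qed

end
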